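(* Let $p$ be a prime number. If $B(x)\in\overline{\mathbb{Q}}[x]$ is a Belyi polynomial of degree less than $p$ with $B(0)=0$, then $\operatorname{New}_p(B(x)-1)$ is a line segment.
   Context: Fix a prime $p$, an algebraic closure $\overline{\mathbb{Q}}_p$ of the field $\mathbb{Q}_p$ of $p$-adic numbers, and an algebraic closure $\overline{\mathbb{Q}}$ of $\mathbb{Q}$ embedded in $\overline{\mathbb{Q}}_p$. Let $\nu_p:\overline{\mathbb{Q}}_p\to\mathbb{R}\cup\{\infty\}$ be the $p$-adic valuation, i.e. the extension to $\overline{\mathbb{Q}}_p$ of the usual $p$-adic valuation on $\mathbb{Q}$ (with $\nu_p(p)=1$ and $\nu_p(0)=\infty$). A (normalized) Belyi polynomial is a nonconstant polynomial $B(x)\in\overline{\mathbb{Q}}[x]$ such that $B(0),B(1)\in\{0,1\}$ and $\{B(x_i): B'(x_i)=0\}\subset\{0,1\}$. For a nonzero polynomial $f(x)=a_0+a_1x+\cdots+a_nx^n$ over $\overline{\mathbb{Q}}$, $\operatorname{Conv}_p(f)$ denotes the convex hull in $\mathbb{R}^2$ of the points $(i,\nu_p(a_i))$ with $a_i\neq 0$. The Newton polygon $\operatorname{New}_p(f(x))$ is the lower boundary of $\operatorname{Conv}_p(f)$: it is $\operatorname{Conv}_p(f)$ itself if that set is a point or a line segment; if $\operatorname{Conv}_p(f)$ is a polygon, it is the union of the segments $[v_0,v_1]\cup\cdots\cup[v_{m-1},v_m]$ joining consecutive vertices of the polygon, listed counter-clockwise from the left-most vertex $v_0$ to the right-most vertex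 $v_m$. *)

theory Defs
  imports "HOL-Analysis.Analysis" "HOL-Computational_Algebra.Computational_Algebra"
begin

section \<open>Valuations, \<open>p\<close>-adic numbers and algebraic closures\<close>

definition padic_val :: "nat \<Rightarrow> rat \<Rightarrow> ereal" where
  "padic_val p q =
     (if q = 0 then \<infinity>
      else ereal (real (multiplicity (int p) (fst (quotient_of q)))
                  - real (multiplicity (int p) (snd (quotient_of q)))))"

definition valuation :: "('a::field \<Rightarrow> ereal) \<Rightarrow> bool" where
  "valuation v \<longleftrightarrow>
     (\<forall>x. v x \<noteq> -\<infinity>) \<and> (\<forall>x. v x = \<infinity> \<longleftrightarrow> x = 0) \<and>
     (\<forall>x y. v (x * y) = v x + v y) \<and> (\<forall>x y. min (v x) (v y) \<le> v (x + y))"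

definition val_Cauchy :: "('a::field \<Rightarrow> ereal) \<Rightarrow> (nat \<Rightarrow> 'a) \<Rightarrow> bool" where
  "val_Cauchy v X \<longleftrightarrow> (\<forall>r::real. \<exists>N. \<forall>m\<ge>N. \<forall>n\<ge>N. ereal r < v (X m - X n))"

definition val_tendsto :: "('a::field \<Rightarrow> ereal) \<Rightarrow> (nat \<Rightarrow> 'a) \<Rightarrow> 'a \<Rightarrow> bool" where
  "val_tendsto v X l \<longleftrightarrow> (\<forall>r::real. \<exists>N. \<forall>n\<ge>N. ereal r < v (X n - l))"

text \<open>
  \<open>padic_numbers p w\<close> says that the field \<open>'k\<close> with the valuation \<open>w\<close> is the completion of the
  rational numbers with respect to the \<open>p\<close>-adic valuation. This determines \<open>('k, w)\<close> up to a unique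
  isomorphism of valued fields.
\<close>
definition padic_numbers :: "nat \<Rightarrow> ('k::field_char_0 \<Rightarrow> ereal) \<Rightarrow> bool" where
  "padic_numbers p w \<longleftrightarrow>
     valuation w \<and>
     (\<forall>q. w (of_rat q) = padic_val p q) \<and>
     (\<forall>x. \<forall>r::real. \<exists>q. ereal r < w (x - of_rat q)) \<and>
     (\<forall>X. val_Cauchy w X \<longrightarrow> (\<exists>l. val_tendsto w X l))"

definition field_embedding :: "('a::field \<Rightarrow> 'b::field) \<Rightarrow> bool" where
  "field_embedding h \<longleftrightarrow>
     h 1 = 1 \<and> (\<forall>x y. h (x + y) = h x + h y) \<and> (\<forall>x y. h (x * y) = h x * h y)"

text \<open>
  The codomain of \<open>h\<close> is algebraically closed by its type class, so only algebraicity over the image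
  of \<open>h\<close> has to be required.
\<close>
definition is_algebraic_closure :: "('k::field \<Rightarrow> 'a::alg_closed_field) \<Rightarrow> bool" where
  "is_algebraic_closure h \<longleftrightarrow>
     field_embedding h \<and> (\<forall>x. \<exists>f. f \<noteq> 0 \<and> poly (map_poly h f) x = 0)"


section \<open>Belyi polynomials\<close>

definition belyi_polynomial :: "'c::field poly \<Rightarrow> bool" where
  "belyi_polynomial B \<longleftrightarrow>
     degree B > 0 \<and> poly B 0 \<in> {0, 1} \<and> poly B 1 \<in> {0, 1} \<and>
     {poly B x | x. poly (pderiv B) x = 0} \<subseteq> {0, 1}"


section \<open>Newton polygons\<close>

definition newton_conv :: "('c::field \<Rightarrow> ereal) \<Rightarrow> 'c poly \<Rightarrow> (real \<times> real) set" where
  "newton_conv v f =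
     convex hull {(real i, real_of_ereal (v (coeff f i))) | i. coeff f i \<noteq> 0}"

text \<open>
  Two distinct vertices \<open>a\<close>, \<open>b\<close> of the polygon \<open>C\<close> are consecutive in counter-clockwise order iff
  \<open>C\<close> lies in the closed half plane to the left of the directed line from \<open>a\<close> to \<open>b\<close>.
\<close>
definition ccw_edge :: "(real \<times> real) set \<Rightarrow> real \<times> real \<Rightarrow> real \<times> real \<Rightarrow> bool" where
  "ccw_edge C a b \<longleftrightarrow>
     a extreme_point_of C \<and> b extreme_point_of C \<and> a \<noteq> b \<and>
     (\<forall>z\<in>C. (fst b - fst a) * (snd z - snd a) - (snd b - snd a) * (fst z - fst a) \<ge> 0)"

definition lower_vertices :: "(real \<times> real) set \<Rightarrow> (real \<times> real) list \<Rightarrow> bool" where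
  "lower_vertices C vs \<longleftrightarrow>
     vs \<noteq> [] \<and> distinct vs \<and> (\<forall>u\<in>set vs. u extreme_point_of C) \<and>
     (\<forall>u. u extreme_point_of C \<longrightarrow> fst (hd vs) \<le> fst u \<and> fst u \<le> fst (last vs)) \<and>
     (\<forall>i. Suc i < length vs \<longrightarrow> ccw_edge C (vs ! i) (vs ! Suc i))"

text \<open>
  The convex hull of points with distinct abscissae has only one left-most and only one right-most
  vertex, so for a nonzero \<open>f\<close> whose hull is a polygon there is exactly one list \<open>vs\<close> below.
  A single point is the segment with \<open>a = b\<close>.
\<close>
definition newton_polygon :: "('c::field \<Rightarrow> ereal) \<Rightarrow> 'c poly \<Rightarrow> (real \<times> real) set" where
  "newton_polygon v f =
     (let C = newton_conv v f in
      if \<exists>a b. C = closed_segment a b then C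
      else {z. \<exists>vs i. lower_vertices C vs \<and> Suc i < length vs \<and>
                     z \<in> closed_segment (vs ! i) (vs ! Suc i)})"

end

theory Submission
  imports Defs
begin

text \<open>
  Write \<open>f = B - 1\<close>, \<open>n = deg f\<close> with leading coefficient \<open>a\<close>, and let \<open>R\<close> be the largest \<open>p\<close>-adic
  absolute value of a root of \<open>f\<close>. Since \<open>|f 0| = 1\<close>, if some root were smaller than \<open>R\<close> then
  \<open>|a| R^n > 1\<close>. At a critical point \<open>x\<close> we have \<open>f x \<in> {-1, 0}\<close>, so \<open>x\<close> lies at distance less than
  \<open>R\<close> from some root of \<open>f\<close>. As \<open>n < p\<close>, the integers \<open>1, \<dots>, n\<close> are units, hence an open disc of
  radius \<open>R\<close> containing \<open>k > 0\<close> roots of \<open>f\<close> contains exactly \<open>k - 1\<close> critical points. Comparing the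
  \<open>n\<close> roots with the \<open>n - 1\<close> critical points, there is only one such disc, whereas a root of absolute
  value \<open>R\<close> and a smaller one lie in different discs. So all roots have the same absolute value.
\<close>

section \<open>Non-archimedean absolute values\<close>

locale ultrametric_abs =
  fixes N :: "'a::field \<Rightarrow> real"
  assumes N_0 [simp]: "N 0 = 0"
    and N_pos: "x \<noteq> 0 \<Longrightarrow> N x > 0"
    and N_mult: "N (x * y) = N x * N y"
    and N_add: "N (x + y) \<le> max (N x) (N y)"
begin

lemma N_nonneg [simp]: "N x \<ge> 0"
  using N_pos[of x] by (cases "x = 0") auto

lemma N_eq_0_iff [simp]: "N x = 0 \<longleftrightarrow> x = 0"
  using N_pos[of x] by (cases "x = 0") auto

lemma N_1 [simp]: "N 1 = 1"
  using N_mult[of 1 1] N_pos[of 1] by simp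

lemma N_minus [simp]: "N (- x) = N x"
proof -
  have "N (- 1) * N (- 1) = 1"
    using N_mult[of "- 1" "- 1"] by simp
  then have "N (- 1) = 1"
    using N_nonneg[of "- 1"] by (metis abs_of_nonneg abs_square_eq_1 power2_eq_square)
  then show ?thesis
    using N_mult[of "- 1" x] by simp
qed

lemma N_diff: "N (x - y) \<le> max (N x) (N y)"
  using N_add[of x "- y"] by simp

lemma N_diff_commute: "N (x - y) = N (y - x)"
  using N_minus[of "x - y"] by simp

lemma N_diff_less: "N x < r \<Longrightarrow> N y < r \<Longrightarrow> N (x - y) < r"
  using N_diff[of x y] by simp

lemma N_diff_eq: "N (x - y) = N x" if "N y < N x"
  using that N_diff[of x y] N_add[of "x - y" y] by (simp add: max_def split: if_splits)

lemma N_prod_mset: "N (\<Prod>x\<in>#A. g x) = (\<Prod>x\<in>#A. N (g x))"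
  by (induction A) (auto simp: N_mult)

text \<open>
  The least index of a coefficient attaining the Gauss norm of radius \<open>R\<close>; it counts the roots in the
  open disc of radius \<open>R\<close> around \<open>0\<close>, and differentiation lowers it by one.
\<close>
definition least_dominant :: "real \<Rightarrow> 'a poly \<Rightarrow> nat \<Rightarrow> bool" where
  "least_dominant R f k \<longleftrightarrow> coeff f k \<noteq> 0 \<and>
     (\<forall>i. N (coeff f i) * R ^ i \<le> N (coeff f k) * R ^ k) \<and>
     (\<forall>i<k. N (coeff f i) * R ^ i < N (coeff f k) * R ^ k)"

lemma least_dominant_unique:
  assumes "least_dominant R f k" "least_dominant R f l"
  shows "k = l"
  using assms unfolding least_dominant_def by (metis linorder_neqE_nat not_le)

lemma least_dominant_smult:
  assumes "least_dominant R f k" "c \<noteq> 0"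
  shows "least_dominant R (smult c f) k"
  using assms N_pos[of c] by (simp add: least_dominant_def N_mult mult.assoc)

text \<open>Each coefficient of the product is a shifted coefficient of \<open>f\<close> minus
  \<open>r\<close> times an unshifted one. The shifted part has weighted maximum
  \<open>R * M\<close>, first attained at \<open>Suc k\<close>; the scaled part has
  \<open>N r * M\<close>, first attained at \<open>k\<close> unless \<open>r = 0\<close>. The larger
  maximum decides. A tie \<open>N r = R\<close> goes to \<open>k\<close>, since up to
  \<open>k\<close> the shifted part stays strictly below \<open>R * M\<close>.\<close>

lemma least_dominant_linear_factor:
  assumes R: "R > 0" and f: "least_dominant R f k"
  shows "least_dominant R ([:-r, 1:] * f) (if N r < R then Suc k else k)"
proof -
  define M where "M = N (coeff f k) * R ^ k"
  have M: "M > 0" "\<And>i. N (coeff f i) * R ^ i \<le> M" "\<And>i. i < k \<Longrightarrow> N (coeff f i) * R ^ i < M"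
    using f R N_pos by (auto simp: least_dominant_def M_def)
  define s where "s i = (case i of 0 \<Rightarrow> 0 | Suc j \<Rightarrow> coeff f j)" for i
  define t where "t i = r * coeff f i" for i
  have c: "coeff ([:-r, 1:] * f) i = s i - t i" for i
    by (simp add: s_def t_def coeff_pCons split: nat.split)
  have s: "N (s i) * R ^ i \<le> R * M" for i
    using M R by (cases i) (auto simp: s_def mult.left_commute)
  have s': "N (s i) * R ^ i < R * M" if "i \<le> k" for i
    using M R that by (cases i) (auto simp: s_def mult.left_commute)
  have sk: "N (s (Suc k)) * R ^ Suc k = R * M"
    by (simp add: s_def M_def mult.left_commute)
  have t: "N (t i) * R ^ i \<le> N r * M" for i
    using mult_left_mono[OF M(2)[of i] N_nonneg[of r]] by (simp add: t_def N_mult mult.assoc)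
  have t': "N (t i) * R ^ i < N r * M" if "i < k" "r \<noteq> 0" for i
    using M(3)[OF that(1)] N_pos[OF that(2)] by (simp add: t_def N_mult mult.assoc)
  have tk: "N (t k) * R ^ k = N r * M"
    by (simp add: t_def M_def N_mult mult.assoc)
  have d: "N (s i - t i) * R ^ i \<le> max (N (s i) * R ^ i) (N (t i) * R ^ i)" for i
    using mult_right_mono[OF N_diff[of "s i" "t i"], of "R ^ i"] R
    by (simp add: max_mult_distrib_right)
  show ?thesis
  proof (cases "N r < R")
    case True
    then have rM: "N r * M < R * M"
      using M by simp
    have "N (t (Suc k)) * R ^ Suc k < N (s (Suc k)) * R ^ Suc k"
      using t[of "Suc k"] sk rM by linarith
    then have "N (t (Suc k)) < N (s (Suc k))"
      using R by (meson mult_less_cancel_right_disj zero_less_power less_asym')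
    then have e: "N (s (Suc k) - t (Suc k)) = N (s (Suc k))"
      by (rule N_diff_eq)
    have "N (s (Suc k)) * R ^ Suc k > 0"
      using sk M R by (simp del: power_Suc)
    then have nz: "s (Suc k) - t (Suc k) \<noteq> 0"
      using e by force
    have "N (s i - t i) * R ^ i \<le> R * M" for i
      using d[of i] s[of i] t[of i] rM by linarith
    moreover have "N (s i - t i) * R ^ i < R * M" if "i < Suc k" for i
      using d[of i] s'[of i] t[of i] rM that by linarith
    ultimately show ?thesis
      using True nz unfolding least_dominant_def c by (simp only: e sk if_True) auto
  next
    case False
    then have Rr: "R * M \<le> N r * M" and r: "r \<noteq> 0"
      using M R by auto
    have "N (s k) * R ^ k < N (t k) * R ^ k"
      using s'[of k] tk Rr by linarith
    then have "N (s k) < N (t k)"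
      using R by (meson mult_less_cancel_right_disj zero_less_power less_asym')
    then have e: "N (s k - t k) = N (t k)"
      using N_diff_eq N_diff_commute by metis
    have "N (t k) * R ^ k > 0"
      using tk M N_pos[OF r] by simp
    then have nz: "s k - t k \<noteq> 0"
      using e by force
    have "N (s i - t i) * R ^ i \<le> N r * M" for i
      using d[of i] s[of i] t[of i] Rr by linarith
    moreover have "N (s i - t i) * R ^ i < N r * M" if "i < k" for i
      using d[of i] s'[of i] t'[of i] Rr r that by linarith
    ultimately show ?thesis
      using False nz unfolding least_dominant_def c by (simp only: e tk if_False) auto
  qed
qed

lemma least_dominant_linear_factors:
  assumes "R > 0" "c \<noteq> 0"
  shows "least_dominant R (smult c (\<Prod>x\<in>#A. [:-x, 1:])) (size {#x\<in>#A. N x < R#})"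
proof -
  have "least_dominant R (\<Prod>x\<in>#A. [:-x, 1:]) (size {#x\<in>#A. N x < R#})"
  proof (induction A)
    case empty
    show ?case
      by (auto simp: least_dominant_def coeff_1)
  next
    case (add r A)
    then show ?case
      using least_dominant_linear_factor[OF assms(1) add, of r] by (auto simp del: mult_pCons_left)
  qed
  then show ?thesis
    using assms(2) by (rule least_dominant_smult)
qed

text \<open>The factors \<open>Suc i\<close> brought down by differentiation have absolute value 1
  up to the degree, so the weighted coefficients of the derivative are those of \<open>f\<close>
  moved down one place and divided by \<open>R\<close>. Losing the constant term does no harm,
  because the least dominant index of \<open>f\<close> is positive.\<close>

lemma least_dominant_pderiv:
  assumes R: "R > 0" and f: "least_dominant R f (Suc k)"
    and N_nat: "\<And>i. 0 < i \<Longrightarrow> i \<le> degree f \<Longrightarrow> N (of_nat i) = 1"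
  shows "least_dominant R (pderiv f) k"
proof -
  have eq: "N (coeff (pderiv f) i) * R ^ i = N (coeff f (Suc i)) * R ^ Suc i / R" for i
  proof (cases "Suc i \<le> degree f")
    case True
    then show ?thesis
      using N_nat[of "Suc i"] R by (simp add: coeff_pderiv N_mult del: of_nat_Suc)
  next
    case False
    then show ?thesis
      by (simp add: coeff_pderiv coeff_eq_0)
  qed
  have "Suc k \<le> degree f"
    using f by (simp add: least_dominant_def le_degree)
  then have "N (of_nat (Suc k)) = 1"
    by (intro N_nat) auto
  then have "of_nat (Suc k) \<noteq> (0 :: 'a)"
    by (metis N_0 zero_neq_one)
  then show ?thesis
    using f R unfolding least_dominant_def eq
    by (simp add: coeff_pderiv divide_le_cancel divide_less_cancel del: of_nat_Suc power_Suc)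
qed

section \<open>Roots and critical points in open discs\<close>

lemma pcompose_linear_factors:
  "pcompose (smult c (\<Prod>x\<in>#A. [:-x, 1:])) [:z, 1:] =
     smult c (\<Prod>x\<in>#image_mset (\<lambda>x. x - z) A. [:-x, 1 :: 'a:])"
proof -
  have "pcompose (\<Prod>x\<in>#A. [:-x, 1:]) [:z, 1:] = (\<Prod>x\<in>#image_mset (\<lambda>x. x - z) A. [:-x, 1:])"
    by (induction A) (auto simp: pcompose_mult pcompose_pCons pcompose_1 simp del: mult_pCons_left)
  then show ?thesis
    by (simp only: pcompose_smult)
qed

text \<open>Translation by \<open>z\<close> carries the disc around \<open>z\<close> to the disc
  around 0, where the dominant index counts roots.\<close>

lemma least_dominant_shifted_linear_factors:
  assumes "R > 0" "c \<noteq> 0"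
  shows "least_dominant R (pcompose (smult c (\<Prod>x\<in>#A. [:-x, 1:])) [:z, 1:])
           (size {#x\<in>#A. N (x - z) < R#})"
proof -
  have "size {#y\<in>#image_mset (\<lambda>x. x - z) A. N y < R#} = size {#x\<in>#A. N (x - z) < R#}"
    by (induction A) auto
  then show ?thesis
    using least_dominant_linear_factors[OF assms, of "image_mset (\<lambda>x. x - z) A"]
    by (simp only: pcompose_linear_factors)
qed

text \<open>The centre is itself a root, so the dominant index of the translated polynomial is a
  successor and drops by one under differentiation. Factoring the derivative gives that index a
  second time, as a count of critical points; uniqueness equates the two.\<close>

lemma size_critical_points_disc:
  assumes "R > 0" "a \<noteq> 0" "b \<noteq> 0"
    and f: "f = smult a (\<Prod>x\<in>#A. [:-x, 1:])"
    and f': "pderiv f = smult b (\<Prod>x\<in>#C. [:-x, 1:])"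
    and N_nat: "\<And>i. 0 < i \<Longrightarrow> i \<le> degree f \<Longrightarrow> N (of_nat i) = 1"
    and z: "z \<in># A"
  shows "size {#x\<in>#A. N (x - z) < R#} = Suc (size {#x\<in>#C. N (x - z) < R#})"
proof -
  let ?k = "size {#x\<in>#A. N (x - z) < R#}"
  have "z \<in># {#x\<in>#A. N (x - z) < R#}"
    using z \<open>R > 0\<close> by simp
  then obtain k where k: "?k = Suc k"
    by (metis Suc_pred nonempty_has_size empty_not_add_mset multi_member_split)
  have "pderiv (pcompose f [:z, 1:]) = pcompose (pderiv f) [:z, 1:]"
    by (simp add: pderiv_pcompose pderiv_pCons)
  moreover have "least_dominant R (pderiv (pcompose f [:z, 1:])) k"
  proof (rule least_dominant_pderiv)
    show "least_dominant R (pcompose f [:z, 1:]) (Suc k)"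
      using least_dominant_shifted_linear_factors[OF assms(1,2), of A z] by (simp only: f k)
  qed (use assms in \<open>simp_all add: degree_pcompose\<close>)
  moreover have "least_dominant R (pcompose (pderiv f) [:z, 1:]) (size {#x\<in>#C. N (x - z) < R#})"
    unfolding f' using assms(1,3) by (rule least_dominant_shifted_linear_factors)
  ultimately show ?thesis
    using k least_dominant_unique by metis
qed

text \<open>Every point of an ultrametric open disc is a centre of it, so discs of equal radius that
  meet coincide.\<close>

lemma discs_eq:
  assumes "N (x - y) < R" "N (x - z) < R"
  shows "{t. N (t - y) < R} = {t. N (t - z) < R}"
proof -
  have "N (t - z) < R \<longleftrightarrow> N (t - y) < R" for t
  proof -
    have "N (y - z) < R"
      using N_diff_less[OF assms(2,1)] by simp
    then show ?thesis
      using N_diff_less[of "t - z" R "y - z"] N_diff_less[of "t - y" R "z - y"]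
      by (auto simp: N_diff_commute)
  qed
  then show ?thesis
    by auto
qed

end

section \<open>Counting with multiplicity and comparing products\<close>

lemma size_eq_sum_disjoint_cover:
  assumes "finite D" "set_mset A \<subseteq> \<Union>D" "\<And>X Y x. X \<in> D \<Longrightarrow> Y \<in> D \<Longrightarrow> x \<in> X \<Longrightarrow> x \<in> Y \<Longrightarrow> X = Y"
  shows "size A = (\<Sum>X\<in>D. size {#x\<in>#A. x \<in> X#})"
  using assms(2)
proof (induction A)
  case (add a A)
  then obtain X where X: "X \<in> D" "a \<in> X"
    by auto
  \<comment> \<open>Disjointness puts the new element into \<open>X\<close> alone, so exactly one
    summand grows, by one.\<close>
  have "size {#x\<in>#add_mset a A. x \<in> Y#} = size {#x\<in>#A. x \<in> Y#} + (if Y = X then 1 else 0)"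
    if "Y \<in> D" for Y
  proof -
    have "a \<in> Y \<longleftrightarrow> Y = X"
      using assms(3)[OF that X(1) _ X(2)] X(2) by blast
    then show ?thesis
      by simp
  qed
  then have "(\<Sum>Y\<in>D. size {#x\<in>#add_mset a A. x \<in> Y#}) =
      (\<Sum>Y\<in>D. size {#x\<in>#A. x \<in> Y#}) + (\<Sum>Y\<in>D. if Y = X then 1 else 0)"
    by (simp only: sum.distrib cong: sum.cong)
  then show ?case
    using add X assms(1) by simp
qed simp

lemma prod_mset_mono_real:
  fixes g h :: "'b \<Rightarrow> real"
  assumes "\<And>x. x \<in># A \<Longrightarrow> 0 \<le> g x \<and> g x \<le> h x"
  shows "0 \<le> (\<Prod>x\<in>#A. g x) \<and> (\<Prod>x\<in>#A. g x) \<le> (\<Prod>x\<in>#A. h x)"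
  using assms by (induction A) (auto intro!: mult_mono mult_nonneg_nonneg intro: order_trans)

lemma prod_mset_strict_mono_real:
  fixes g h :: "'b \<Rightarrow> real"
  assumes "\<And>x. x \<in># A \<Longrightarrow> 0 < g x \<and> g x \<le> h x" "z \<in># A" "g z < h z"
  shows "(\<Prod>x\<in>#A. g x) < (\<Prod>x\<in>#A. h x)"
proof -
  obtain A' where A: "A = add_mset z A'"
    using assms(2) by (metis multi_member_split)
  \<comment> \<open>Strictness at \<open>z\<close> survives multiplication only because the
    remaining product is positive.\<close>
  have "0 < (\<Prod>x\<in>#A'. g x)"
    using assms(1) unfolding A by (induction A') (force intro: mult_pos_pos)+
  moreover have "(\<Prod>x\<in>#A'. g x) \<le> (\<Prod>x\<in>#A'. h x)"
    using prod_mset_mono_real[of A' g h] assms(1) unfolding A by (auto intro: less_imp_le)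
  ultimately show ?thesis
    using assms(3) assms(1)[of z] unfolding A by (auto intro!: mult_less_le_imp_less)
qed

section \<open>Equality of the absolute values of all roots\<close>

context ultrametric_abs
begin

lemma N_poly_linear_factors:
  "N (poly (smult a (\<Prod>x\<in>#A. [:-x, 1:])) y) = N a * (\<Prod>x\<in>#A. N (y - x))"
  by (simp add: poly_prod_mset N_mult N_prod_mset image_mset.compositionality comp_def)

text \<open>The multiset \<open>C\<close> is one smaller than \<open>A\<close>, while each disc of
  radius \<open>R\<close> around a root loses exactly one point in passing from \<open>A\<close> to
  \<open>C\<close>. Once these discs are known to contain all of \<open>C\<close>, only one disc can
  exist.\<close>

lemma roots_same_abs:
  assumes "a \<noteq> 0" "b \<noteq> 0"
    and f: "f = smult a (\<Prod>x\<in>#A. [:-x, 1:])"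
    and f': "pderiv f = smult b (\<Prod>x\<in>#C. [:-x, 1:])"
    and sizes: "size A = Suc (size C)"
    and N_nat: "\<And>i. 0 < i \<Longrightarrow> i \<le> degree f \<Longrightarrow> N (of_nat i) = 1"
    and f0: "N (poly f 0) = 1"
    and crit: "\<And>x. x \<in># C \<Longrightarrow> N (poly f x) \<le> 1"
    and z: "z \<in># A" and z': "z' \<in># A"
  shows "N z = N z'"
proof (rule ccontr)
  assume neq: "N z \<noteq> N z'"
  define R where "R = Max (N ` set_mset A)"
  have le: "N x \<le> R" if "x \<in># A" for x
    using that by (simp add: R_def)
  have "R \<in> N ` set_mset A"
    unfolding R_def using z by (intro Max_in) auto
  then obtain y where y: "y \<in># A" "N y = R"
    by auto
  obtain u where u: "u \<in># A" "N u < R"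
    using le[OF z] le[OF z'] neq z z' by (metis order_le_imp_less_or_eq)
  have R: "R > 0"
    using u(2) N_nonneg[of u] by linarith
  have A0: "N a * (\<Prod>x\<in>#A. N x) = 1"
    using f0 N_poly_linear_factors[of a A 0] by (simp add: f)
  have pos: "N x > 0" if x: "x \<in># A" for x
  proof -
    obtain A' where "A = add_mset x A'"
      using multi_member_split[OF x] by auto
    then have "x \<noteq> 0"
      using A0 by auto
    then show ?thesis
      by (rule N_pos)
  qed
  \<comment> \<open>The smaller root \<open>u\<close> makes this strict; multiplied by
    \<open>N a\<close>, the left side is \<open>N (poly f 0) = 1\<close>.\<close>
  have "(\<Prod>x\<in>#A. N x) < (\<Prod>x\<in>#A. R)"
    using prod_mset_strict_mono_real[of A N "\<lambda>_. R", OF _ u] le pos by simp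
  then have big: "1 < N a * (\<Prod>x\<in>#A. R)"
    using A0 N_pos[OF \<open>a \<noteq> 0\<close>] by (metis mult_less_cancel_left_pos)
  \<comment> \<open>As a set of discs rather than a family indexed by roots, \<open>D\<close> counts
    coinciding discs once.\<close>
  define D where "D = (\<lambda>z. {t. N (t - z) < R}) ` set_mset A"
  have cover: "set_mset C \<subseteq> \<Union>D"
  proof
    fix x assume x: "x \<in># C"
    show "x \<in> \<Union>D"
    proof (rule ccontr)
      assume "x \<notin> \<Union>D"
      \<comment> \<open>Outside all discs every factor \<open>N (x - y)\<close> is at least
        \<open>R\<close>, which makes \<open>N (poly f x)\<close> exceed 1 and contradicts
        \<open>crit\<close>.\<close>
      then have "0 \<le> R \<and> R \<le> N (x - y)" if "y \<in># A" for y
        using that R by (auto simp: D_def not_less)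
      then have "(\<Prod>x\<in>#A. R) \<le> (\<Prod>y\<in>#A. N (x - y))"
        using prod_mset_mono_real[of A "\<lambda>_. R" "\<lambda>y. N (x - y)"] by auto
      then have "N a * (\<Prod>x\<in>#A. R) \<le> N (poly f x)"
        unfolding f N_poly_linear_factors by (intro mult_left_mono) auto
      then show False
        using big crit[OF x] by linarith
    qed
  qed
  have fin: "finite D"
    by (simp add: D_def)
  have disj: "X = Y" if "X \<in> D" "Y \<in> D" "x \<in> X" "x \<in> Y" for X Y x
  proof -
    obtain y z where "X = {t. N (t - y) < R}" "Y = {t. N (t - z) < R}"
      using \<open>X \<in> D\<close> \<open>Y \<in> D\<close> by (auto simp: D_def)
    then show ?thesis
      using \<open>x \<in> X\<close> \<open>x \<in> Y\<close> discs_eq[of x y R z] by simp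
  qed
  have coverA: "set_mset A \<subseteq> \<Union>D"
    using R by (auto simp: D_def)
  have "size A = (\<Sum>X\<in>D. size {#x\<in>#A. x \<in> X#})"
    by (rule size_eq_sum_disjoint_cover[OF fin coverA]) (fact disj)
  also have "\<dots> = (\<Sum>X\<in>D. size {#x\<in>#C. x \<in> X#} + 1)"
  proof (rule sum.cong)
    fix X assume "X \<in> D"
    then obtain t where "t \<in># A" "X = {x. N (x - t) < R}"
      by (auto simp: D_def)
    then show "size {#x\<in>#A. x \<in> X#} = size {#x\<in>#C. x \<in> X#} + 1"
      using size_critical_points_disc[OF R assms(1,2) f f' N_nat] by simp
  qed simp
  also have "\<dots> = (\<Sum>X\<in>D. size {#x\<in>#C. x \<in> X#}) + card D"
    by (simp only: sum.distrib card_eq_sum)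
  also have "(\<Sum>X\<in>D. size {#x\<in>#C. x \<in> X#}) = size C"
    by (rule size_eq_sum_disjoint_cover[OF fin cover, symmetric]) (fact disj)
  finally have "card D = 1"
    using sizes by simp
  then obtain X where X: "D = {X}"
    by (auto simp: card_1_singleton_iff)
  have disc_eq: "{t. N (t - u) < R} = {t. N (t - y) < R}"
    using X u(1) y(1) unfolding D_def by (metis (mono_tags, lifting) imageI singletonD)
  \<comment> \<open>The common disc also has centre \<open>u\<close>, so \<open>y\<close> is closer
    than \<open>R\<close> to \<open>u\<close>; yet \<open>N u < N y\<close> forces
    \<open>N (y - u) = N y = R\<close>.\<close>
  have "y \<in> {t. N (t - y) < R}"
    using R by simp
  then have "N (y - u) < R"
    by (simp only: disc_eq[symmetric] mem_Collect_eq)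
  moreover have "N (y - u) = N y"
    using u y by (intro N_diff_eq) simp
  ultimately show False
    using y by simp
qed

text \<open>No root lies in the open disc of radius \<open>R\<close> around 0, so index 0 is
  dominant. The constant term is, up to sign, \<open>c\<close> times the product of the
  roots.\<close>

lemma coeff_bound_roots_same_abs:
  assumes "R > 0" "c \<noteq> 0" "\<And>x. x \<in># A \<Longrightarrow> N x = R"
  defines "f \<equiv> smult c (\<Prod>x\<in>#A. [:-x, 1:])"
  shows "N (coeff f i) * R ^ i \<le> N (coeff f 0)" "N (coeff f 0) = N c * R ^ size A"
proof -
  have "{#x\<in>#A. N x < R#} = {#}"
    using assms(3) by (force simp: multiset_eq_iff not_in_iff[symmetric])
  then have "least_dominant R f 0"
    using least_dominant_linear_factors[OF assms(1,2), of A] unfolding f_def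
    by (simp only: size_empty)
  then show "N (coeff f i) * R ^ i \<le> N (coeff f 0)"
    by (auto simp: least_dominant_def)
  have "(\<Prod>x\<in>#A. N x) = (\<Prod>x\<in>#A. R)"
    using assms(3) by (simp cong: image_mset_cong)
  then show "N (coeff f 0) = N c * R ^ size A"
    using N_poly_linear_factors[of c A 0] by (simp add: f_def poly_0_coeff_0)
qed

end

section \<open>Newton polygons\<close>

text \<open>All points lie on or above a line of slope \<open>L\<close> that passes through the
  first and the last one, so the lower boundary is the chord between these two. If the hull is not
  itself a segment, the chord arises from the only possible list of lower vertices.\<close>

lemma newton_polygon_eq_segment:
  fixes f :: "'c::field poly" and v :: "'c \<Rightarrow> ereal"
  defines "y \<equiv> \<lambda>i. real_of_ereal (v (coeff f i))"
  assumes n: "degree f > 0" and c0: "coeff f 0 \<noteq> 0"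
    and ge: "\<And>i. coeff f i \<noteq> 0 \<Longrightarrow> y i \<ge> y 0 + real i * L"
    and eq: "y (degree f) = y 0 + real (degree f) * L"
  shows "\<exists>a b. a \<noteq> b \<and> newton_polygon v f = closed_segment a b"
proof -
  define m where "m = degree f"
  define S where "S = {i. coeff f i \<noteq> 0}"
  define pt where "pt i = (real i, y i)" for i
  define C where "C = newton_conv v f"
  have C: "C = convex hull (pt ` S)"
    unfolding C_def newton_conv_def pt_def S_def y_def by (rule arg_cong[of _ _ "\<lambda>X. convex hull X"]) auto
  have cm: "coeff f m \<noteq> 0"
    using n by (auto simp: m_def)
  have S: "0 \<in> S" "m \<in> S" "\<And>i. i \<in> S \<Longrightarrow> i \<le> m" "finite S"
    using c0 cm by (auto simp: S_def m_def le_degree intro: finite_subset[of _ "{..degree f}"])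
  have m: "m > 0"
    using n by (simp add: m_def)
  have inC: "pt i \<in> C" if "i \<in> S" for i
    unfolding C using that by (intro hull_inc) auto
  have neq: "pt 0 \<noteq> pt m"
    using m by (simp add: pt_def)
  show ?thesis
  proof (cases "\<exists>a b. C = closed_segment a b")
    case True
    then obtain a b where ab: "C = closed_segment a b"
      by auto
    have "a \<noteq> b"
    proof
      assume "a = b"
      then have "C = {a}" using ab by simp
      then show False using inC S neq by (metis singletonD)
    qed
    moreover have "newton_polygon v f = C"
      using True by (simp add: newton_polygon_def Let_def C_def)
    ultimately show ?thesis
      using ab by metis
  next
    case False
    \<comment> \<open>All other points have positive abscissa, so \<open>pt 0\<close> is outside
      their hull. The mirrored argument serves \<open>pt m\<close>.\<close>
    have ext0: "pt 0 extreme_point_of C"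
    proof -
      have "convex hull (pt ` (S - {0})) \<subseteq> {z. fst z > 0}"
      proof (rule hull_minimal)
        show "convex {z :: real \<times> real. fst z > 0}"
          using convex_halfspace_gt[of 0 "(1 :: real, 0 :: real)"] by (simp add: inner_prod_def)
      qed (auto simp: pt_def)
      then have "pt 0 \<notin> convex hull (pt ` (S - {0}))"
        by (auto simp: pt_def)
      moreover have "pt ` S = insert (pt 0) (pt ` (S - {0}))"
        using S by auto
      ultimately show ?thesis
        unfolding C using S(4) by (metis extreme_point_of_convex_hull_insert finite_Diff finite_imageI)
    qed
    have extm: "pt m extreme_point_of C"
    proof -
      have "convex hull (pt ` (S - {m})) \<subseteq> {z. fst z < m}"
      proof (rule hull_minimal)
        show "convex {z :: real \<times> real. fst z < m}"
          using convex_halfspace_lt[of "(1 :: real, 0 :: real)" m] by (simp add: inner_prod_def)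
      qed (use S in \<open>fastforce simp: pt_def\<close>)
      then have "pt m \<notin> convex hull (pt ` (S - {m}))"
        by (auto simp: pt_def)
      moreover have "pt ` S = insert (pt m) (pt ` (S - {m}))"
        using S by auto
      ultimately show ?thesis
        unfolding C using S(4) by (metis extreme_point_of_convex_hull_insert finite_Diff finite_imageI)
    qed
    have below: "C \<subseteq> {z. snd z - L * fst z \<ge> y 0}"
      unfolding C
    proof (rule hull_minimal)
      show "convex {z :: real \<times> real. snd z - L * fst z \<ge> y 0}"
        using convex_halfspace_ge[of "y 0" "(- L, 1 :: real)"] by (simp add: inner_prod_def)
      show "pt ` S \<subseteq> {z. snd z - L * fst z \<ge> y 0}"
        using ge by (auto simp: pt_def S_def algebra_simps)
    qed
    have ext: "\<exists>i\<in>S. u = pt i" if "u extreme_point_of C" for u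
      using extreme_point_of_convex_hull that unfolding C by blast
    have lower: "lower_vertices C [pt 0, pt m]"
      unfolding lower_vertices_def
    proof (intro conjI allI impI)
      fix u assume "u extreme_point_of C"
      then obtain i where "i \<in> S" "u = pt i"
        using ext by blast
      then show "fst (hd [pt 0, pt m]) \<le> fst u" "fst u \<le> fst (last [pt 0, pt m])"
        using S by (auto simp: pt_def)
    next
      fix i assume "Suc i < length [pt 0, pt m]"
      moreover have "real m * (snd z - y 0) - (y m - y 0) * fst z \<ge> 0" if "z \<in> C" for z
      proof -
        \<comment> \<open>The orientation determinant is \<open>m\<close> times the height of
          \<open>z\<close> above the supporting line.\<close>
        have "real m * (snd z - y 0) - (y m - y 0) * fst z = real m * (snd z - L * fst z - y 0)"
          using eq by (simp add: m_def algebra_simps)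
        also have "\<dots> \<ge> 0"
          using below that by (intro mult_nonneg_nonneg) auto
        finally show ?thesis .
      qed
      ultimately show "ccw_edge C ([pt 0, pt m] ! i) ([pt 0, pt m] ! Suc i)"
        using ext0 extm neq by (auto simp: ccw_edge_def pt_def)
    qed (use ext0 extm neq in auto)
    have unique: "vs = [pt 0, pt m]" if vs: "lower_vertices C vs" for vs
    proof -
      have ne: "vs \<noteq> []" and dist: "distinct vs" and vext: "\<And>u. u \<in> set vs \<Longrightarrow> u extreme_point_of C"
        and edge: "\<And>i. Suc i < length vs \<Longrightarrow> ccw_edge C (vs ! i) (vs ! Suc i)"
        using vs by (auto simp: lower_vertices_def)
      obtain i where i: "i \<in> S" "hd vs = pt i"
        using ext vext ne by (metis hd_in_set)
      have "fst (hd vs) \<le> fst (pt 0)"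
        using vs ext0 unfolding lower_vertices_def by blast
      then have hd: "hd vs = pt 0"
        using i by (simp add: pt_def)
      obtain j where j: "j \<in> S" "last vs = pt j"
        using ext vext ne by (metis last_in_set)
      have "fst (pt m) \<le> fst (last vs)"
        using vs extm unfolding lower_vertices_def by blast
      then have last: "last vs = pt m"
        using j S(3)[of j] by (auto simp: pt_def)
      obtain e rest where vs_eq: "vs = pt 0 # e # rest"
        using hd last neq ne by (metis last_ConsL list.exhaust_sel)
      have ce: "ccw_edge C (pt 0) e"
        using edge[of 0] vs_eq by simp
      then have ee: "e extreme_point_of C" and e0: "e \<noteq> pt 0"
        by (auto simp: ccw_edge_def)
      obtain k where k: "k \<in> S" "e = pt k"
        using ext[OF ee] by auto
      have k0: "k \<noteq> 0"
        using e0 k(2) by metis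
      \<comment> \<open>Testing the half plane of the edge from \<open>pt 0\<close> to
        \<open>e\<close> at the point \<open>pt m\<close> shows that \<open>e\<close> is not above
        the line; with \<open>ge\<close> it lies on the line.\<close>
      have "real k * (y m - y 0) - (y k - y 0) * real m \<ge> 0"
        using ce inC[OF S(2)] k unfolding ccw_edge_def by (auto simp: pt_def)
      then have "real m * (y k - y 0 - real k * L) \<le> 0"
        using eq by (simp add: m_def algebra_simps)
      then have "y k - y 0 - real k * L \<le> 0"
        using m by (simp add: mult_le_0_iff)
      then have yk: "y k = y 0 + real k * L"
        using ge[of k] k by (simp add: S_def)
      \<comment> \<open>A point of the line strictly between the two ends lies in an open segment of
        \<open>C\<close>, hence is not extreme.\<close>
      have "k = m"
      proof (rule ccontr)
        assume "k \<noteq> m"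
        then have km: "k < m"
          using S(3)[OF k(1)] by simp
        define t where "t = real k / real m"
        have t: "0 < t" "t < 1" "t * real m = real k"
          using k0 km by (auto simp: t_def)
        have "e = (1 - t) *\<^sub>R pt 0 + t *\<^sub>R pt m"
          using t eq yk k(2) by (simp add: pt_def m_def algebra_simps)
        then have "e \<in> open_segment (pt 0) (pt m)"
          using t neq by (auto simp: in_segment)
        then show False
          using ee inC S unfolding extreme_point_of_def by blast
      qed
      \<comment> \<open>The list already contains \<open>pt m\<close> and must end there, so
        distinctness leaves no room for a tail.\<close>
      then have "rest = []"
        using vs_eq last dist k(2) by (cases rest rule: rev_cases) auto
      then show ?thesis
        using vs_eq k \<open>k = m\<close> by simp
    qed
    have "newton_polygon v f = {z. \<exists>vs i. lower_vertices C vs \<and> Suc i < length vs \<and>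
                     z \<in> closed_segment (vs ! i) (vs ! Suc i)}"
      using False by (simp add: newton_polygon_def Let_def C_def)
    also have "\<dots> = closed_segment (pt 0) (pt m)"
    proof -
      have "lower_vertices C vs \<longleftrightarrow> vs = [pt 0, pt m]" for vs
        using unique lower by blast
      then show ?thesis
        by simp
    qed
    finally show ?thesis
      using neq by blast
  qed
qed

section \<open>Belyi polynomials of degree less than \<open>p\<close>\<close>

lemma field_embedding_simps:
  assumes "field_embedding h"
  shows "h 0 = 0" "h 1 = 1" "h (x + y) = h x + h y" "h (x * y) = h x * h y"
    "h (of_nat i) = of_nat i" "h x = 0 \<longleftrightarrow> x = 0"
proof -
  show 1: "h 1 = 1" and add: "h (x + y) = h x + h y" and mult: "h (x * y) = h x * h y" for x y
    using assms by (auto simp: field_embedding_def)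
  show 0: "h 0 = 0"
    using add[of 0 0] by (metis add_0 add_right_cancel)
  show "h (of_nat i) = of_nat i"
    by (induction i) (auto simp: 0 1 add)
  show "h x = 0 \<longleftrightarrow> x = 0"
    using 0 1 mult[of x "inverse x"] by (cases "x = 0") auto
qed

lemma valuation_comp:
  assumes "valuation v" "field_embedding h"
  shows "valuation (\<lambda>x. v (h x))"
  using assms unfolding valuation_def by (simp add: field_embedding_simps[OF assms(2)])

text \<open>The map \<open>exp (- t)\<close> turns sums into products and reverses order, so minima
  become maxima. Zero needs its own case: \<open>real_of_ereal\<close> sends infinity to 0, and the
  exponential would give 1.\<close>

lemma valuation_ultrametric_abs:
  assumes "valuation v"
  shows "ultrametric_abs (\<lambda>x. if x = 0 then 0 else exp (- real_of_ereal (v x)))"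
proof -
  have r: "v x = ereal (real_of_ereal (v x))" if "x \<noteq> 0" for x
    using assms that by (cases "v x") (auto simp: valuation_def)
  have mult: "real_of_ereal (v (x * y)) = real_of_ereal (v x) + real_of_ereal (v y)"
    if "x \<noteq> 0" "y \<noteq> 0" for x y
    using assms r[OF that(1)] r[OF that(2)] unfolding valuation_def
    by (metis plus_ereal.simps(1) real_of_ereal.simps(1))
  have add: "min (real_of_ereal (v x)) (real_of_ereal (v y)) \<le> real_of_ereal (v (x + y))"
    if "x \<noteq> 0" "y \<noteq> 0" "x + y \<noteq> 0" for x y
  proof -
    have "min (v x) (v y) \<le> v (x + y)"
      using assms by (simp add: valuation_def)
    then have "min (ereal (real_of_ereal (v x))) (ereal (real_of_ereal (v y)))
        \<le> ereal (real_of_ereal (v (x + y)))"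
      using r that by metis
    then show ?thesis
      by (simp add: min_def split: if_splits)
  qed
  show ?thesis
  proof
    fix x y :: 'a
    show "(if x * y = 0 then 0 else exp (- real_of_ereal (v (x * y)))) =
        (if x = 0 then 0 else exp (- real_of_ereal (v x))) *
        (if y = 0 then 0 else exp (- real_of_ereal (v y)))"
      by (simp add: mult exp_add exp_diff exp_minus field_simps)
    show "(if x + y = 0 then 0 else exp (- real_of_ereal (v (x + y)))) \<le>
        max (if x = 0 then 0 else exp (- real_of_ereal (v x)))
          (if y = 0 then 0 else exp (- real_of_ereal (v y)))"
      using add[of x y] by (auto simp: max_def min_def split: if_splits)
  qed simp_all
qed

theorem theorem2:
  fixes p :: nat
    and w :: "'k::field_char_0 \<Rightarrow> ereal"
    and \<iota> :: "'k \<Rightarrow> 'a::alg_closed_field"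
    and \<nu> :: "'a \<Rightarrow> ereal"
    and \<sigma> :: "'c::{alg_closed_field, field_char_0} \<Rightarrow> 'a"
    and B :: "'c poly"
  assumes "prime p"
    and "padic_numbers p w"
    and "is_algebraic_closure \<iota>"
    and "valuation \<nu>" and "\<forall>x. \<nu> (\<iota> x) = w x"
    and "is_algebraic_closure (of_rat :: rat \<Rightarrow> 'c)"
    and "field_embedding \<sigma>"
    and "belyi_polynomial B"
    and "degree B < p"
    and "poly B 0 = 0"
  shows "\<exists>a b. a \<noteq> b \<and> newton_polygon (\<lambda>x. \<nu> (\<sigma> x)) (B - 1) = closed_segment a b"
proof -
  define v where "v = (\<lambda>x. \<nu> (\<sigma> x))"
  define N where "N = (\<lambda>x. if x = 0 then 0 else exp (- real_of_ereal (v x)))"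
  have "valuation v"
    unfolding v_def using assms(4,7) by (rule valuation_comp)
  then interpret ultrametric_abs N
    unfolding N_def by (rule valuation_ultrametric_abs)
  have N_nat: "N (of_nat i) = 1" if "0 < i" "i < p" for i
  proof -
    \<comment> \<open>Both embeddings preserve natural numbers, so the value can be read off in the
      rationals, where \<open>p\<close> does not divide a positive \<open>i < p\<close>.\<close>
    have "v (of_nat i) = w (of_nat i)"
      using assms(3,5,7) unfolding v_def is_algebraic_closure_def
      by (metis field_embedding_simps(5))
    also have "\<dots> = padic_val p (of_nat i)"
      using assms(2) unfolding padic_numbers_def by (metis of_rat_of_nat_eq)
    also have "\<dots> = 0"
    proof -
      have "\<not> int p dvd int i"
        using that by (auto dest: dvd_imp_le)
      then show ?thesis
        using that by (simp add: padic_val_def not_dvd_imp_multiplicity_0 zero_ereal_def)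
    qed
    finally show ?thesis
      using that by (simp add: N_def)
  qed
  define f where "f = B - 1"
  have degB: "degree B > 0"
    using assms(8) by (simp add: belyi_polynomial_def)
  have degf: "degree f = degree B"
    using degree_add_eq_left[of "- 1" B] degB by (simp add: f_def)
  have pf: "pderiv f = pderiv B"
    by (simp add: f_def pderiv_diff)
  have f0: "f \<noteq> 0" "pderiv f \<noteq> 0"
    using degf degB by (auto simp: pderiv_eq_0_iff)
  define a where "a = lead_coeff f"
  define b where "b = lead_coeff (pderiv f)"
  have ab: "a \<noteq> 0" "b \<noteq> 0"
    using f0 by (auto simp: a_def b_def)
  obtain A where A: "size A = degree f" "f = smult a (\<Prod>x\<in>#A. [:-x, 1:])"
    unfolding a_def
    using alg_closed_imp_factorization[OF f0(1)] by blast
  obtain C where C: "size C = degree (pderiv f)" "pderiv f = smult b (\<Prod>x\<in>#C. [:-x, 1:])"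
    unfolding b_def
    using alg_closed_imp_factorization[OF f0(2)] by blast
  have crit: "N (poly f x) \<le> 1" if "x \<in># C" for x
  proof -
    have "poly (pderiv f) x = 0"
      using that by (subst C(2)) (auto simp: poly_prod_mset prod_mset_zero_iff)
    then have "poly B x \<in> {0, 1}"
      using assms(8) pf by (auto simp: belyi_polynomial_def)
    then show ?thesis
      by (auto simp: f_def)
  qed
  have fz: "coeff f 0 = - 1"
    using assms(10) by (simp add: f_def poly_0_coeff_0)
  have "A \<noteq> {#}"
    using A(1) degf degB by auto
  then obtain z where z: "z \<in># A"
    by blast
  have same: "N x = N z" if "x \<in># A" for x
  proof (rule roots_same_abs[OF ab A(2) C(2)])
    \<comment> \<open>In characteristic 0 differentiation lowers the degree by exactly one.\<close>
    show "size A = Suc (size C)"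
      using A(1) C(1) degf degB by (simp add: degree_pderiv)
    show "N (of_nat i) = 1" if "0 < i" "i \<le> degree f" for i
      using that N_nat degf assms(9) by simp
    show "N (poly f 0) = 1"
      using fz by (simp add: poly_0_coeff_0)
  qed (use that z crit in auto)
  have "poly f z = 0"
    using z by (subst A(2)) (auto simp: poly_prod_mset prod_mset_zero_iff)
  then have "z \<noteq> 0"
    using fz by (auto simp: poly_0_coeff_0)
  define R where "R = N z"
  have R: "R > 0"
    using N_pos[OF \<open>z \<noteq> 0\<close>] by (simp add: R_def)
  have bound: "N (coeff f i) * R ^ i \<le> 1" for i
    using coeff_bound_roots_same_abs(1)[OF R ab(1), of A i, folded A(2)] same fz
    by (simp add: R_def)
  have lead: "N (lead_coeff f) * R ^ degree f = 1"
    using coeff_bound_roots_same_abs(2)[OF R ab(1), of A, folded A(2)] same fz A(1)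
    by (simp add: R_def a_def)
  have N_ln: "real_of_ereal (v x) = - ln (N x)" if "x \<noteq> 0" for x
    using that by (simp add: N_def)
  have ln_prod: "ln (N x * R ^ i) = ln (N x) + real i * ln R" if "x \<noteq> 0" for x i
    using R N_pos[OF that] by (simp add: ln_mult_pos ln_realpow)
  \<comment> \<open>Since \<open>v\<close> is \<open>- ln\<close> of \<open>N\<close> off zero,
    \<open>bound\<close> becomes a lower bound \<open>i * ln R\<close> for the valuation of
    coefficient \<open>i\<close>, with equality at the degree by \<open>lead\<close>. This is where
    the slope \<open>ln R\<close> comes from.\<close>
  have "\<exists>a b. a \<noteq> b \<and> newton_polygon v f = closed_segment a b"
  proof (rule newton_polygon_eq_segment[where L = "ln R"])
    show "degree f > 0" "coeff f 0 \<noteq> 0"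
      using degf degB fz by auto
    have y0: "real_of_ereal (v (coeff f 0)) = 0"
      using N_ln[of "- 1"] by (simp add: fz)
    show "real_of_ereal (v (coeff f i)) \<ge> real_of_ereal (v (coeff f 0)) + real i * ln R"
      if "coeff f i \<noteq> 0" for i
    proof -
      have "ln (N (coeff f i) * R ^ i) \<le> ln 1"
        using bound[of i] R N_pos[OF that] by (intro ln_mono) auto
      then show ?thesis
        unfolding N_ln[OF that] y0 by (simp add: ln_prod[OF that])
    qed
    have "ln (N (lead_coeff f) * R ^ degree f) = 0"
      by (simp add: lead)
    then show "real_of_ereal (v (lead_coeff f)) =
        real_of_ereal (v (coeff f 0)) + real (degree f) * ln R"
      unfolding N_ln[OF ab(1)[unfolded a_def]] y0 ln_prod[OF ab(1)[unfolded a_def]] by linarith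
  qed
  then show ?thesis
    by (simp add: v_def f_def)
qed

end
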